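(* Let $V=\mathbb{C}^n$ and let $A$ be a commutative (not necessarily associative, not necessarily unital) algebra structure on $V$, i.e. a point of $\mathcal{A}=S^2V^*\otimes V$. Suppose $A\notin\mathcal{D}_1\cup\mathcal{D}_2$. Then $A$ has no nonzero quasiderivations: $Q\mathrm{Der}(A)=0$.
   Context: $\mathcal{D}_1\subset\mathcal{A}$ is the set of algebras containing a quadratic nilpotent, i.e. a nonzero $v$ with $v^2=0$. A one-dimensional subalgebra $U\subset A$ is singular if there exist linearly independent $u\in U$, $v\in A$ and $\alpha\in\mathbb{C}$ with $u^2=\alpha u$ and $uv=\frac{\alpha}{2}v$; $\mathcal{D}_2\subset\mathcal{A}$ is the set of algebras containing a singular one-dimensional subalgebra. The Lie algebra $\mathfrak{gl}(V)$ acts on bilinear multiplications $\mu$ by $(D\cdot\mu)(x,y)=D(\mu(x,y))-\mu(Dx,y)-\mu(x,Dy)$. A linear operator $D\in\mathrm{End}(V)$ is a quasiderivation of $A=(V,\mu)$ if $D\cdot(D\cdot\mu)=0$; $Q\mathrm{Der}(A)$ denotes the set of quasiderivations. *)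

theory Defs
  imports "HOL-Analysis.Analysis"
begin


definition cbilinear :: "(complex^('n::finite) \<Rightarrow> complex^'n \<Rightarrow> complex^'n) \<Rightarrow> bool" where
  "cbilinear \<mu> \<longleftrightarrow> (\<forall>x. Vector_Spaces.linear (*s) (*s) (\<mu> x))
                  \<and> (\<forall>y. Vector_Spaces.linear (*s) (*s) (\<lambda>x. \<mu> x y))"

definition commutative_mult :: "(complex^('n::finite) \<Rightarrow> complex^'n \<Rightarrow> complex^'n) \<Rightarrow> bool" where
  "commutative_mult \<mu> \<longleftrightarrow> (\<forall>x y. \<mu> x y = \<mu> y x)"

text \<open>Action of gl(V) on bilinear multiplications.\<close>
definition gl_act :: "(complex^('n::finite) \<Rightarrow> complex^('n::finite)) \<Rightarrow> (complex^('n::finite) \<Rightarrow> complex^'n \<Rightarrow> complex^'n) \<Rightarrow> (complex^('n::finite) \<Rightarrow> complex^'n \<Rightarrow> complex^'n)" where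
  "gl_act D \<mu> = (\<lambda>x y. D (\<mu> x y) - \<mu> (D x) y - \<mu> x (D y))"

definition QDer :: "(complex^('n::finite) \<Rightarrow> complex^'n \<Rightarrow> complex^'n) \<Rightarrow> (complex^('n::finite) \<Rightarrow> complex^('n::finite)) set" where
  "QDer \<mu> = {D. Vector_Spaces.linear (*s) (*s) D \<and> gl_act D (gl_act D \<mu>) = (\<lambda>x y. 0)}"

text \<open>D1: contains a quadratic nilpotent.\<close>
definition in_D1 :: "(complex^('n::finite) \<Rightarrow> complex^'n \<Rightarrow> complex^'n) \<Rightarrow> bool" where
  "in_D1 \<mu> \<longleftrightarrow> (\<exists>v. v \<noteq> 0 \<and> \<mu> v v = 0)"

definition subalgebra :: "(complex^('n::finite) \<Rightarrow> complex^'n \<Rightarrow> complex^'n) \<Rightarrow> (complex^('n::finite)) set \<Rightarrow> bool" where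
  "subalgebra \<mu> U \<longleftrightarrow> vec.subspace U \<and> (\<forall>x\<in>U. \<forall>y\<in>U. \<mu> x y \<in> U)"

definition singular_subalgebra :: "(complex^('n::finite) \<Rightarrow> complex^'n \<Rightarrow> complex^'n) \<Rightarrow> (complex^('n::finite)) set \<Rightarrow> bool" where
  "singular_subalgebra \<mu> U \<longleftrightarrow> subalgebra \<mu> U \<and> vec.dim U = 1 \<and>
     (\<exists>u v (\<alpha>::complex). u \<in> U \<and> u \<noteq> v \<and> vec.independent {u, v} \<and>
         \<mu> u u = \<alpha> *s u \<and> \<mu> u v = (\<alpha> / 2) *s v)"

text \<open>D2: contains a singular one-dimensional subalgebra.\<close>
definition in_D2 :: "(complex^('n::finite) \<Rightarrow> complex^'n \<Rightarrow> complex^'n) \<Rightarrow> bool" where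
  "in_D2 \<mu> \<longleftrightarrow> (\<exists>U. singular_subalgebra \<mu> U)"

end

theory Submission
  imports "HOL-Homology.Homology" Defs "HOL-Computational_Algebra.Fundamental_Theorem_Algebra"
begin

text \<open>
Let \<open>D\<close> be a quasiderivation, and write \<open>\<nu> = D \<cdot> \<mu>\<close>, so that \<open>D \<cdot> \<nu> = 0\<close>.
If \<open>D v = a v\<close> then \<open>(D - 2a)\<^sup>2 v\<^sup>2 = 0\<close>; as \<open>v\<^sup>2 \<noteq> 0\<close>, the number \<open>2a\<close> is again an eigenvalue,
and iterating contradicts boundedness of \<open>D\<close> unless \<open>a = 0\<close>. So \<open>D\<close> is nilpotent.

Let \<open>p\<close> be maximal with \<open>D\<^sup>p \<noteq> 0\<close>, and let \<open>s\<close> denote the Leibniz operator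
\<open>(s \<beta>)(x, y) = \<beta>(D x, y) + \<beta>(x, D y)\<close>. Then \<open>D\<^sup>k \<mu> = s\<^sup>k \<mu> + k s\<^sup>k\<^sup>-\<^sup>1 \<nu>\<close> and \<open>D\<^sup>k \<nu> = s\<^sup>k \<nu>\<close>,
which for \<open>k = p + 1\<close> force \<open>s\<^sup>p\<^sup>+\<^sup>2 \<mu> = 0\<close>. If \<open>p \<ge> 2\<close>, then \<open>s\<^sup>2\<^sup>p \<mu> = 0\<close>, and evaluating at \<open>(x, x)\<close>
leaves only a multiple of \<open>(D\<^sup>p x)\<^sup>2\<close>: a quadratic nilpotent.

If \<open>p = 1\<close>, the image of \<open>D\<close> is a subalgebra. It contains \<open>w = D x \<noteq> 0\<close> with \<open>w\<^sup>2 = \<alpha> w\<close>, and the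
quasiderivation identity says that \<open>x\<close> is an eigenvector of \<open>w\<close> modulo \<open>ker D\<close> with eigenvalue \<open>\<alpha>/2\<close>;
so \<open>\<alpha>/2\<close> is an eigenvalue of multiplication by \<open>w\<close>.

The element \<open>w\<close> comes from topology. If no such \<open>w\<close> existed in a (real) algebra, the normalised squaring
map on the unit sphere would be homotopic to the identity, hence of degree 1. But it is an
even map that sends the equator to a set of measure zero, and such maps have even degree.
\<close>

section \<open>Degrees of even maps\<close>

text \<open>Points of \<open>nsphere n\<close> are functions on all of \<open>nat\<close> that
  vanish above \<open>n\<close>, hence the default 0 there. The zero vector is sent to zero, so
  nonvanishing hypotheses accompany this map below.\<close>

definition nsphere_normalize :: "nat \<Rightarrow> (nat \<Rightarrow> real) \<Rightarrow> nat \<Rightarrow> real" where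
  "nsphere_normalize n x = (\<lambda>i. if i \<le> n then x i / sqrt (\<Sum>j\<le>n. (x j)\<^sup>2) else 0)"

lemma nsphere_normalize_ident:
  assumes "x \<in> topspace (nsphere n)" "c > 0"
  shows "nsphere_normalize n (\<lambda>i. c * x i) = x"
proof -
  have "(\<Sum>j\<le>n. (c * x j)\<^sup>2) = c\<^sup>2"
    using assms by (simp add: nsphere power_mult_distrib flip: sum_distrib_left)
  then show ?thesis
    using assms by (auto simp: nsphere_normalize_def nsphere)
qed

lemma nsphere_normalize_eqD:
  assumes eq: "nsphere_normalize n x = nsphere_normalize n y"
    and x: "\<exists>i\<le>n. x i \<noteq> 0" and y: "\<exists>i\<le>n. y i \<noteq> 0"
  obtains c where "c > 0" "\<And>i. i \<le> n \<Longrightarrow> y i = c * x i"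
proof
  define r where "r = (\<lambda>x::nat \<Rightarrow> real. sqrt (\<Sum>j\<le>n. (x j)\<^sup>2))"
  have pos: "r x > 0" if nz: "\<exists>i\<le>n. x i \<noteq> 0" for x
  proof -
    obtain i where "i \<le> n" "x i \<noteq> 0" using nz by blast
    then show ?thesis unfolding r_def real_sqrt_gt_0_iff by (intro sum_pos2 [of _ i]) auto
  qed
  show "r y / r x > 0" using pos [OF x] pos [OF y] by simp
  have "x i / r x = y i / r y" if "i \<le> n" for i
    using that fun_cong [OF eq, of i] by (simp add: nsphere_normalize_def r_def)
  then show "y i = r y / r x * x i" if "i \<le> n" for i
    using that pos [OF x] pos [OF y] by (simp add: field_simps)
qed

lemma continuous_map_nsphere_normalize:
  assumes cont: "\<And>i. i \<le> n \<Longrightarrow> continuous_map Z euclideanreal (\<lambda>z. g z i)"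
    and nz: "\<And>z. z \<in> topspace Z \<Longrightarrow> \<exists>i\<le>n. g z i \<noteq> 0"
  shows "continuous_map Z (nsphere n) (\<lambda>z. nsphere_normalize n (g z))"
proof -
  have pos: "(\<Sum>j\<le>n. (g z j)\<^sup>2) > 0" if z: "z \<in> topspace Z" for z
  proof -
    obtain i where "i \<le> n" "g z i \<noteq> 0" using nz [OF z] by blast
    then show ?thesis by (intro sum_pos2 [of _ i]) auto
  qed
  have "continuous_map Z euclideanreal (\<lambda>z. sqrt (\<Sum>j\<le>n. (g z j)\<^sup>2))"
    by (intro continuous_map_sqrt continuous_map_sum continuous_map_real_pow cont) auto
  then have "continuous_map Z euclideanreal (\<lambda>z. g z k / sqrt (\<Sum>j\<le>n. (g z j)\<^sup>2))" if "k \<le> n" for k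
    by (intro continuous_map_real_divide cont that) (use pos in force)+
  then have "continuous_map Z euclideanreal (\<lambda>z. nsphere_normalize n (g z) k)" for k
    by (cases "k \<le> n") (simp_all add: nsphere_normalize_def)
  moreover have "(\<Sum>i\<le>n. (nsphere_normalize n (g z) i)\<^sup>2) = 1" if "z \<in> topspace Z" for z
    using pos [OF that] by (simp add: nsphere_normalize_def power_divide less_imp_le flip: sum_divide_distrib)
  ultimately show ?thesis
    by (auto simp: nsphere continuous_map_in_subtopology continuous_map_componentwise_UNIV nsphere_normalize_def)
qed

text \<open>The straight-line homotopy, projected radially. The set \<open>T\<close> serves two
  uses: the complement of a point, to contract a punctured sphere, and \<open>UNIV\<close>, to
  compare degrees.\<close>

lemma homotopic_nsphere_normalize_linear:
  assumes f: "\<And>i. i \<le> n \<Longrightarrow> continuous_map Z euclideanreal (\<lambda>z. f z i)"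
    and g: "\<And>i. i \<le> n \<Longrightarrow> continuous_map Z euclideanreal (\<lambda>z. g z i)"
    and nz: "\<And>z t. z \<in> topspace Z \<Longrightarrow> 0 \<le> t \<Longrightarrow> t \<le> 1 \<Longrightarrow> \<exists>i\<le>n. (1 - t) * f z i + t * g z i \<noteq> 0"
    and T: "\<And>z t. z \<in> topspace Z \<Longrightarrow> 0 \<le> t \<Longrightarrow> t \<le> 1 \<Longrightarrow>
      nsphere_normalize n (\<lambda>i. (1 - t) * f z i + t * g z i) \<in> T"
  shows "homotopic_with (\<lambda>_. True) Z (subtopology (nsphere n) T)
    (\<lambda>z. nsphere_normalize n (f z)) (\<lambda>z. nsphere_normalize n (g z))"
proof -
  define h where "h \<equiv> \<lambda>(t, z) i. (1 - t) * f z i + t * g z i"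
  let ?Y = "prod_topology (top_of_set {0..1::real}) Z"
  have "continuous_map ?Y (nsphere n) (\<lambda>y. nsphere_normalize n (h y))"
  proof (rule continuous_map_nsphere_normalize)
    fix i assume i: "i \<le> n"
    have t: "continuous_map ?Y euclideanreal fst"
      using continuous_map_fst continuous_map_in_subtopology by blast
    have "continuous_map ?Y euclideanreal (\<lambda>y. f (snd y) i)" "continuous_map ?Y euclideanreal (\<lambda>y. g (snd y) i)"
      using continuous_map_compose [OF continuous_map_snd f [OF i]]
        continuous_map_compose [OF continuous_map_snd g [OF i]] by (auto simp: o_def)
    then have "continuous_map ?Y euclideanreal (\<lambda>y. (1 - fst y) * f (snd y) i + fst y * g (snd y) i)"
      by (intro continuous_map_add continuous_map_real_mult continuous_map_diff t) auto
    then show "continuous_map ?Y euclideanreal (\<lambda>y. h y i)"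
      by (simp add: h_def case_prod_unfold)
  next
    fix y assume "y \<in> topspace ?Y"
    then show "\<exists>i\<le>n. h y i \<noteq> 0"
      using nz by (auto simp: h_def)
  qed
  moreover have "nsphere_normalize n (h y) \<in> T" if "y \<in> topspace ?Y" for y
    using T that by (auto simp: h_def)
  ultimately have "continuous_map ?Y (subtopology (nsphere n) T) (\<lambda>y. nsphere_normalize n (h y))"
    by (auto simp: continuous_map_in_subtopology)
  then show ?thesis
    unfolding homotopic_with_def by (intro exI [of _ "\<lambda>y. nsphere_normalize n (h y)"]) (auto simp: h_def)
qed

lemma contractible_space_punctured_nsphere:
  assumes q: "q \<in> topspace (nsphere n)"
  shows "contractible_space (subtopology (nsphere n) (-{q}))"
proof -
  let ?Z = "subtopology (nsphere n) (-{q})"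
  have q1: "(\<Sum>i\<le>n. (q i)\<^sup>2) = 1" and q0: "\<And>i. i > n \<Longrightarrow> q i = 0"
    using q by (auto simp: nsphere)
  then have uq: "(\<lambda>i. - q i) \<in> topspace (nsphere n)"
    by (simp add: nsphere)
  \<comment> \<open>The equation reads \<open>(1 - t) z = (c + t) q\<close>; norms give
    \<open>1 - t = c + t\<close>, so \<open>z = q\<close>. Taking \<open>c = 0\<close> shows that
    the segment from \<open>z\<close> to \<open>-q\<close> avoids the origin, and
    \<open>c > 0\<close> that its projection avoids \<open>q\<close>.\<close>
  have ray: "z = q" if z: "z \<in> topspace (nsphere n)" and t: "0 \<le> t" "t \<le> 1"
    and c: "c \<ge> 0" and eq: "\<And>i. i \<le> n \<Longrightarrow> (1 - t) * z i + t * - q i = c * q i" for z t c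
  proof -
    have z1: "(\<Sum>i\<le>n. (z i)\<^sup>2) = 1" and z0: "\<And>i. i > n \<Longrightarrow> z i = 0"
      using z by (auto simp: nsphere)
    have zq: "(1 - t) * z i = (c + t) * q i" if "i \<le> n" for i
      using eq [OF that] by (simp add: algebra_simps)
    then have "(\<Sum>i\<le>n. ((1 - t) * z i)\<^sup>2) = (\<Sum>i\<le>n. ((c + t) * q i)\<^sup>2)"
      by simp
    then have "(1 - t)\<^sup>2 = (c + t)\<^sup>2"
      by (simp add: power_mult_distrib z1 q1 flip: sum_distrib_left)
    then have "1 - t = c + t"
      using c t by (simp add: power2_eq_iff_nonneg)
    with c t zq have "z i = q i" if "i \<le> n" for i
      using that by force
    then show "z = q"
      using z0 q0 by (metis ext not_le)
  qed
  have proj: "continuous_map ?Z euclideanreal (\<lambda>z. z i)" for i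
    by (simp add: continuous_map_from_subtopology continuous_map_nsphere_projection)
  have "homotopic_with (\<lambda>_. True) ?Z ?Z (nsphere_normalize n) (\<lambda>z. nsphere_normalize n (\<lambda>i. - q i))"
  proof (rule homotopic_nsphere_normalize_linear [OF proj])
    fix z :: "nat \<Rightarrow> real" and t :: real
    assume z: "z \<in> topspace ?Z" and t: "0 \<le> t" "t \<le> 1"
    have nz: "\<exists>i\<le>n. (1 - t) * z i + t * - q i \<noteq> 0"
      using ray [of z t 0] z t by fastforce
    then show "\<exists>i\<le>n. (1 - t) * z i + t * - q i \<noteq> 0" .
    define s where "s = sqrt (\<Sum>i\<le>n. ((1 - t) * z i + t * - q i)\<^sup>2)"
    have "s > 0"
    proof -
      obtain i where "i \<le> n" "(1 - t) * z i + t * - q i \<noteq> 0"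
        using nz by blast
      then show ?thesis
        unfolding s_def real_sqrt_gt_0_iff by (intro sum_pos2 [of _ i]) auto
    qed
    show "nsphere_normalize n (\<lambda>i. (1 - t) * z i + t * - q i) \<in> - {q}"
    proof
      assume "nsphere_normalize n (\<lambda>i. (1 - t) * z i + t * - q i) \<in> {q}"
      then have "((1 - t) * z i + t * - q i) / s = q i" if "i \<le> n" for i
        using that by (auto simp: nsphere_normalize_def s_def dest!: fun_cong [of _ _ i])
      then have "(1 - t) * z i + t * - q i = s * q i" if "i \<le> n" for i
        using that \<open>s > 0\<close> by (auto simp: field_simps)
      then show False
        using ray [of z t s] z t \<open>s > 0\<close> by auto
    qed
  qed auto
  moreover have "nsphere_normalize n z = z" if "z \<in> topspace ?Z" for z
    using nsphere_normalize_ident [of z n 1] that by auto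
  ultimately have "homotopic_with (\<lambda>_. True) ?Z ?Z id (\<lambda>z. nsphere_normalize n (\<lambda>i. - q i))"
    by (auto elim!: homotopic_with_eq)
  then show ?thesis
    unfolding contractible_space_def by blast
qed

lemma continuous_map_nsphere_uminus: "continuous_map (nsphere n) (nsphere n) (\<lambda>x i. - x i)"
proof -
  have "continuous_map (powertop_real UNIV) euclideanreal (\<lambda>x. - x k)" for k :: nat
    by (metis UNIV_I continuous_map_product_projection continuous_map_minus)
  then show ?thesis
    by (force simp: nsphere continuous_map_in_subtopology continuous_map_componentwise_UNIV
        intro: continuous_map_from_subtopology)
qed

text \<open>If the antipode has degree -1, composing with it forces degree 0. Otherwise it fixes the
  generator of top homology, and the two hemispheres contribute equally to the degree. By
  \<open>fq\<close>, \<open>f\<close> maps the pair (sphere, equator) into the pair (sphere,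
  complement of \<open>q\<close>), where the contributions can be compared.\<close>

theorem even_Brouwer_degree2_even_map:
  assumes cmf: "continuous_map (nsphere n) (nsphere n) f"
    and ev: "\<And>x. x \<in> topspace (nsphere n) \<Longrightarrow> f (\<lambda>i. - x i) = f x"
    and q: "q \<in> topspace (nsphere n)"
    and fq: "\<And>x. x \<in> topspace (nsphere n) \<Longrightarrow> x n = 0 \<Longrightarrow> f x \<noteq> q"
  shows "even (Brouwer_degree2 n f)"
proof -
  define neg where "neg \<equiv> \<lambda>x::nat\<Rightarrow>real. \<lambda>i. - x i"
  define U where "U \<equiv> {x::nat\<Rightarrow>real. x n \<ge> 0}"
  define L where "L \<equiv> {x::nat\<Rightarrow>real. x n \<le> 0}"
  define E where "E \<equiv> {x::nat\<Rightarrow>real. x n = 0}"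
  define X where "X \<equiv> nsphere n"
  define XU where "XU \<equiv> subtopology X U"
  define XL where "XL \<equiv> subtopology X L"
  define R where "R \<equiv> reduced_homology_group (int n) X"
  define G where "G \<equiv> relative_homology_group (int n) X E"
  define GL where "GL \<equiv> relative_homology_group (int n) XL E"
  define GU where "GU \<equiv> relative_homology_group (int n) XU E"
  define Q where "Q \<equiv> relative_homology_group (int n) X (-{q})"
  define iL where "iL \<equiv> hom_induced (int n) XL E X E id"
  define iU where "iU \<equiv> hom_induced (int n) XU E X E id"
  define N where "N \<equiv> hom_induced (int n) X E X E neg"
  define NL where "NL \<equiv> hom_induced (int n) XL E XU E neg"
  define NU where "NU \<equiv> hom_induced (int n) XU E XL E neg"
  define F where "F \<equiv> hom_induced (int n) X E X (-{q}) f"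
  define K where "K \<equiv> hom_induced (int n) X {} X (-{q}) id"
  define J where "J \<equiv> hom_induced (int n) X {} X E id"
  have cmf': "continuous_map X X f" using cmf by (simp add: X_def)
  have cm_neg: "continuous_map X X neg"
    using continuous_map_nsphere_uminus by (simp add: X_def neg_def)
  have nE: "neg \<in> E \<rightarrow> E" by (auto simp: neg_def E_def)
  have cm_LU: "continuous_map XL XU neg" and cm_UL: "continuous_map XU XL neg"
    using cm_neg by (auto simp: XL_def XU_def L_def U_def neg_def continuous_map_from_subtopology continuous_map_in_subtopology)
  have cm_iL: "continuous_map XL X id" and cm_iU: "continuous_map XU X id"
    by (auto simp: XL_def XU_def continuous_map_from_subtopology)
  interpret G: comm_group G by (simp add: G_def)
  interpret R: group R by (simp add: R_def)
  \<comment> \<open>Homology relative to the equator is the direct sum over the hemispheres: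
    excision identifies each hemisphere relative to \<open>E\<close> with the sphere relative to the
    other one, and the sequences of the two triples then split.\<close>
  have iso: "(\<lambda>(x, y). iL x \<otimes>\<^bsub>G\<^esub> iU y) \<in> iso (GL \<times>\<times> GU) G"
    unfolding G_def GL_def GU_def iL_def iU_def
  proof (rule conjunct1 [OF exact_sequence_sum_lemma [OF abelian_relative_homology_group]])
    show "hom_induced n XL E X U id \<in> Group.iso (relative_homology_group n XL E) (relative_homology_group n X U)"
      unfolding XL_def E_def L_def U_def X_def
      using iso_relative_homology_group_lower_hemisphere by blast
    show "hom_induced n XU E X L id \<in> Group.iso (relative_homology_group n XU E) (relative_homology_group n X L)"
      unfolding XU_def E_def L_def U_def X_def
      using iso_relative_homology_group_upper_hemisphere by blast
    show "exact_seq ([relative_homology_group n X L, relative_homology_group n X E, relative_homology_group n XL E],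
          [hom_induced n X E X L id, hom_induced n XL E X E id])"
      unfolding XL_def L_def E_def by (rule homology_exactness_triple_3) force
    show "exact_seq ([relative_homology_group n X U, relative_homology_group n X E, relative_homology_group n XU E],
          [hom_induced n X E X U id, hom_induced n XU E X E id])"
      unfolding XU_def U_def E_def by (rule homology_exactness_triple_3) force
  qed (auto simp: hom_induced_compose' subset_iff XL_def XU_def E_def L_def U_def continuous_map_from_subtopology)
  have Ghom: "group_hom G Q F" "group_hom G G N"
    by (simp_all add: group_hom_def group_hom_axioms_def G_def Q_def F_def N_def hom_induced_hom)
  interpret F: group_hom G Q F by (rule Ghom)
  interpret N: group_hom G G N by (rule Ghom)
  \<comment> \<open>The complement of \<open>q\<close> is contractible and contains
    \<open>neg q\<close>, so an identity in \<open>Q\<close> can be pulled back to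
    \<open>R\<close>.\<close>
  have Kiso: "K \<in> iso R Q"
    unfolding K_def R_def Q_def
  proof (rule iso_reduced_homology_by_contractible)
    show "contractible_space (subtopology X (-{q}))"
      using contractible_space_punctured_nsphere q by (simp add: X_def)
    have "neg q \<in> topspace X" "neg q \<noteq> q"
    proof -
      show "neg q \<in> topspace X"
        using cm_neg q by (auto simp: X_def continuous_map_def)
      show "neg q \<noteq> q"
      proof
        assume "neg q = q"
        then have "q i = 0" for i by (auto simp: neg_def fun_eq_iff dest: spec[of _ i])
        then show False using q by (simp add: nsphere)
      qed
    qed
    then show "topspace X \<inter> -{q} \<noteq> {}" by blast
  qed
  then interpret K: group_hom R Q K
    by (simp add: group_hom_def group_hom_axioms_def iso_def Q_def)
  have Kinj: "inj_on K (carrier R)" and Ksurj: "K ` carrier R = carrier Q"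
    using Kiso by (auto simp: iso_iff)
  obtain v where v: "v \<in> carrier R" and vgen: "subgroup_generated R {v} = R"
    using cyclic_reduced_homology_group_nsphere [of n n] by (auto simp: cyclic_group_def R_def X_def)
  have "infinite (carrier R)"
    using iso_finite [OF reduced_homology_group_nsphere(1)] by (simp add: R_def X_def)
  \<comment> \<open>Order 0 encodes infinite order: equal powers of \<open>v\<close> have equal
    integer exponents.\<close>
  then have ordv: "R.ord v = 0"
    using R.infinite_cyclic_subgroup_order [OF v] vgen by simp
  have degf: "hom_induced n X {} X {} f v = v [^]\<^bsub>R\<^esub> Brouwer_degree2 n f" for f
    using Brouwer_degree2 v by (simp add: R_def X_def)
  have negneg: "neg \<circ> neg = id" by (auto simp: neg_def)
  have "homeomorphic_map X X neg"
    using cm_neg negneg by (auto simp: homeomorphic_map_maps homeomorphic_maps_def neg_def intro!: exI [of _ neg])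
  then have "\<bar>Brouwer_degree2 n neg\<bar> = 1"
    using Brouwer_degree2_homeomorphic_map by (simp add: X_def)
  moreover have "Brouwer_degree2 n f * Brouwer_degree2 n neg = Brouwer_degree2 n f"
    using Brouwer_degree2_compose [of n neg f] Brouwer_degree2_eq [of n "f \<circ> neg" f] cm_neg cmf ev
    by (auto simp: X_def neg_def)
  ultimately consider "Brouwer_degree2 n f = 0" | "Brouwer_degree2 n neg = 1"
    by auto
  then show ?thesis
  proof cases
    case 2
    have negv: "hom_induced n X {} X {} neg v = v"
      using degf [of neg] 2 v by simp
    define u where "u \<equiv> J v"
    have uG: "u \<in> carrier G"
      by (simp add: u_def J_def G_def hom_induced_carrier)
    have Nu: "N u = u"
    proof -
      have "N u = hom_induced n X {} X E (neg \<circ> id) v"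
        unfolding N_def u_def J_def by (rule hom_induced_compose' [OF _ _ cm_neg nE]) auto
      also have "\<dots> = J (hom_induced n X {} X {} neg v)"
        unfolding J_def by (subst hom_induced_compose' [OF cm_neg]) auto
      finally show ?thesis by (simp add: negv u_def)
    qed
    \<comment> \<open>the antipode swaps the two hemispheres, so the class splits into a half and its mirror image,
      on which \<open>f\<close> takes the same value\<close>
    obtain x y where xy: "x \<in> carrier GL" "y \<in> carrier GU" and u: "u = iL x \<otimes>\<^bsub>G\<^esub> iU y"
      
    proof -
      have "u \<in> (\<lambda>(x, y). iL x \<otimes>\<^bsub>G\<^esub> iU y) ` carrier (GL \<times>\<times> GU)"
        using iso uG by (simp add: iso_iff)
      then show thesis using that by auto
    qed
    have car: "iL a \<in> carrier G" "iU a \<in> carrier G" "NL a \<in> carrier GU" "NU a \<in> carrier GL" for a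
      by (simp_all add: iL_def iU_def NL_def NU_def G_def GL_def GU_def hom_induced_carrier)
    have NiL: "N (iL x) = iU (NL x)"

    proof -
      have "N (iL x) = hom_induced n XL E X E (neg \<circ> id) x"
        unfolding N_def iL_def by (rule hom_induced_compose' [OF cm_iL _ cm_neg nE]) auto
      also have "\<dots> = iU (NL x)"
        unfolding iU_def NL_def by (subst hom_induced_compose' [OF cm_LU nE cm_iU]) auto
      finally show ?thesis .
    qed
    have NiU: "N (iU y) = iL (NU y)"

    proof -
      have "N (iU y) = hom_induced n XU E X E (neg \<circ> id) y"
        unfolding N_def iU_def by (rule hom_induced_compose' [OF cm_iU _ cm_neg nE]) auto
      also have "\<dots> = iL (NU y)"
        unfolding iL_def NU_def by (subst hom_induced_compose' [OF cm_UL nE cm_iL]) auto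
      finally show ?thesis .
    qed
    have "iL x \<otimes>\<^bsub>G\<^esub> iU y = iL (NU y) \<otimes>\<^bsub>G\<^esub> iU (NL x)"
      using Nu car by (simp add: u NiL NiU G.m_comm)
    then have "(x, y) = (NU y, NL x)"
      using iso xy car by (intro inj_onD [of "\<lambda>(x, y). iL x \<otimes>\<^bsub>G\<^esub> iU y" "carrier (GL \<times>\<times> GU)"]) (auto simp: iso_iff)
    then have "y = NL x"
      by blast
    then have uN: "u = iL x \<otimes>\<^bsub>G\<^esub> N (iL x)"
      by (simp add: u NiL)
    \<comment> \<open>\<open>fq\<close> speaks only of points on the sphere, so \<open>E\<close> is
      cut down to the sphere; the induced maps do not change.\<close>
    have fE: "f \<in> (topspace X \<inter> E) \<rightarrow> - {q}"
      using fq by (auto simp: X_def E_def)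
    have FE: "F = hom_induced n X (topspace X \<inter> E) X (-{q}) f"
      unfolding F_def by (metis hom_induced_restrict inf.left_idem)
    have JE: "J = hom_induced n X {} X (topspace X \<inter> E) id"
      unfolding J_def by (metis hom_induced_restrict inf.left_idem)
    have NE: "N = hom_induced n X (topspace X \<inter> E) X (topspace X \<inter> E) neg"
      unfolding N_def by (metis hom_induced_restrict)
    have "neg \<in> (topspace X \<inter> E) \<rightarrow> topspace X \<inter> E"
      using nE cm_neg by (auto simp: continuous_map_def)
    then have "F (N a) = hom_induced n X (topspace X \<inter> E) X (-{q}) (f \<circ> neg) a" for a
      unfolding FE NE by (rule hom_induced_compose' [OF cm_neg _ cmf' fE])
    also have "hom_induced n X (topspace X \<inter> E) X (-{q}) (f \<circ> neg) = F"
      unfolding FE by (rule hom_induced_eq) (use ev in \<open>simp add: X_def neg_def\<close>)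
    finally have FN: "F (N a) = F a" for a .
    define w where "w = F (iL x)"
    have wQ: "w \<in> carrier Q" by (simp add: w_def car)
    then obtain z where z: "z \<in> carrier R" "w = K z" using Ksurj by blast
    then obtain e :: int where e: "z = v [^]\<^bsub>R\<^esub> e"
      using R.carrier_subgroup_generated_by_singleton [OF v] vgen by auto
    \<comment> \<open>Two routes from \<open>v\<close> to \<open>Q\<close> agree: apply
      \<open>f\<close> and then pass to the pair, or pass to the equator pair and then apply
      \<open>f\<close>.\<close>
    have "K (v [^]\<^bsub>R\<^esub> Brouwer_degree2 n f) = F u"
    proof -
      have "F u = hom_induced n X {} X (-{q}) (f \<circ> id) v"
        unfolding FE u_def JE by (rule hom_induced_compose' [OF _ _ cmf' fE]) auto
      also have "\<dots> = K (hom_induced n X {} X {} f v)"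
        unfolding K_def by (subst hom_induced_compose' [OF cmf']) auto
      finally show ?thesis by (simp add: degf)
    qed
    also have "F u = w \<otimes>\<^bsub>Q\<^esub> w"
      by (simp add: uN car FN w_def)
    also have "\<dots> = K (z \<otimes>\<^bsub>R\<^esub> z)"
      using z by simp
    also have "z \<otimes>\<^bsub>R\<^esub> z = v [^]\<^bsub>R\<^esub> (e + e)"
      by (simp only: e R.int_pow_mult [OF v])
    finally have "v [^]\<^bsub>R\<^esub> Brouwer_degree2 n f = v [^]\<^bsub>R\<^esub> (e + e)"
      using Kinj v by (auto dest: inj_onD)
    then have "Brouwer_degree2 n f = e + e"
      using R.int_pow_eq [OF v] ordv by simp
    then show ?thesis by simp
  qed simp
qed

section \<open>Idempotent lines in real algebras\<close>

text \<open>With no such line, the segment from the square of \<open>w\<close> to \<open>w\<close>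
  never meets 0, so normalised squaring has degree 1 on the unit sphere of \<open>W\<close>, against
  its evenness. The lemma is stated for subspaces because it is applied to the range of a
  quasiderivation with square zero.\<close>

lemma bilinear_idempotent_line:
  fixes b :: "'a::euclidean_space \<Rightarrow> 'a \<Rightarrow> 'a"
  assumes b: "bilinear b" and W: "subspace W" "W \<noteq> {0}"
    and closed: "\<And>w. w \<in> W \<Longrightarrow> b w w \<in> W"
  shows "\<exists>w\<in>W. w \<noteq> 0 \<and> (\<exists>\<alpha>. b w w = \<alpha> *\<^sub>R w)"
proof (rule ccontr)
  assume "\<not> ?thesis"
  then have no: "b w w \<noteq> \<alpha> *\<^sub>R w" if "w \<in> W" "w \<noteq> 0" for w \<alpha>
    using that by blast
  interpret b: bounded_bilinear b
    using b by (simp add: bilinear_conv_bounded_bilinear)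
  obtain B where B: "B \<subseteq> W" "pairwise orthogonal B" "\<And>x. x \<in> B \<Longrightarrow> norm x = 1"
    "independent B" "card B = dim W" "span B = W"
    using orthonormal_basis_subspace [OF W(1)] by metis
  have finB: "finite B" using B(4) finiteI_independent by blast
  have "B \<noteq> {}" using B(6) W(2) by auto
  then obtain n where n: "card B = Suc n"
    using finB by (metis card_0_eq not0_implies_Suc)
  obtain e where e: "bij_betw e {..n} B"
    using ex_bij_betw_nat_finite [OF finB] n by (auto simp: atLeast0LessThan lessThan_Suc_atMost)
  have eB: "e i \<in> B" if "i \<le> n" for i
    using e that by (auto simp: bij_betw_def)
  then have eW: "e i \<in> W" if "i \<le> n" for i
    using B(1) that by blast
  have ee: "e i \<bullet> e j = (if i = j then 1 else 0)" if "i \<le> n" "j \<le> n" for i j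
  proof (cases "i = j")
    case True
    then show ?thesis using B(3) eB that by (simp add: dot_square_norm)
  next
    case False
    then have "e i \<noteq> e j" using e that by (auto simp: bij_betw_def inj_on_def)
    then show ?thesis using B(2) eB that False by (auto simp: pairwise_def orthogonal_def)
  qed
  \<comment> \<open>\<open>\<phi>\<close> builds a vector of \<open>W\<close> from its coordinates
    in the orthonormal basis; \<open>p\<close> is the orthogonal projection of the whole space onto
    \<open>W\<close>.\<close>
  define \<phi> where "\<phi> = (\<lambda>x::nat \<Rightarrow> real. \<Sum>i\<le>n. x i *\<^sub>R e i)"
  define p where "p = (\<lambda>w. \<phi> (\<lambda>i. w \<bullet> e i))"
  have \<phi>W: "\<phi> x \<in> W" for x
    unfolding \<phi>_def by (intro subspace_sum subspace_scale W eW) auto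
  have \<phi>_coord: "\<phi> x \<bullet> e j = x j" if "j \<le> n" for x j
  proof -
    have "\<phi> x \<bullet> e j = (\<Sum>i\<le>n. if i = j then x i else 0)"
      unfolding \<phi>_def inner_sum_left using that by (intro sum.cong) (auto simp: ee)
    then show ?thesis using that by simp
  qed
  have pW: "p w = w" if "w \<in> W" for w
  proof -
    have "p w = (\<Sum>u\<in>B. (w \<bullet> u) *\<^sub>R u)"
      unfolding p_def \<phi>_def by (rule sum.reindex_bij_betw [OF e])
    then show ?thesis
      using orthonormal_basis_expand [OF B(2,3) _ finB] B(6) that by simp
  qed
  have W_eqI: "u = w" if "u \<in> W" "w \<in> W" "\<And>i. i \<le> n \<Longrightarrow> u \<bullet> e i = w \<bullet> e i" for u w
  proof -
    have "p u = p w" unfolding p_def \<phi>_def using that(3) by (intro sum.cong) auto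
    then show ?thesis using pW that by simp
  qed
  have \<phi>0: "\<phi> x \<noteq> 0" if "x \<in> topspace (nsphere n)" for x
  proof
    assume "\<phi> x = 0"
    then have "x i = 0" if "i \<le> n" for i using \<phi>_coord [OF that, of x] by simp
    then show False using \<open>x \<in> topspace (nsphere n)\<close> by (simp add: nsphere)
  qed
  have \<phi>neg: "\<phi> (\<lambda>i. - x i) = - \<phi> x" for x
    by (simp add: \<phi>_def sum_negf)
  define g where "g = (\<lambda>x i. b (\<phi> x) (\<phi> x) \<bullet> e i)"
  define f where "f = (\<lambda>x. nsphere_normalize n (g x))"
  have proj: "continuous_map (nsphere n) euclideanreal (\<lambda>x. x i)" for i
    by (rule continuous_map_nsphere_projection)
  have cont_g: "continuous_map (nsphere n) euclideanreal (\<lambda>x. g x i)" for i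
  proof -
    have "g = (\<lambda>x i. \<Sum>j\<le>n. \<Sum>k\<le>n. x j * x k * (b (e k) (e j) \<bullet> e i))"
      by (simp add: g_def \<phi>_def b.sum_left b.sum_right b.scaleR_left b.scaleR_right inner_sum_left sum_distrib_left mult.assoc)
    then show ?thesis
      by (auto intro!: continuous_map_sum continuous_map_real_mult proj)
  qed
  \<comment> \<open>A zero at \<open>t = 1\<close> would give \<open>\<phi> x = 0\<close>; at any
    other \<open>t\<close>, dividing by \<open>1 - t\<close> makes the square a multiple of
    \<open>\<phi> x\<close>.\<close>
  have line: "\<exists>i\<le>n. (1 - t) * g x i + t * x i \<noteq> 0"
    if x: "x \<in> topspace (nsphere n)" and t: "0 \<le> t" "t \<le> 1" for x t
  proof (rule ccontr)
    assume "\<not> ?thesis"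
    then have *: "(1 - t) * g x i + t * x i = 0" if "i \<le> n" for i
      using that by blast
    have "(1 - t) *\<^sub>R b (\<phi> x) (\<phi> x) + t *\<^sub>R \<phi> x = 0"
    proof (rule W_eqI)
      show "(1 - t) *\<^sub>R b (\<phi> x) (\<phi> x) + t *\<^sub>R \<phi> x \<in> W"
        by (intro subspace_add subspace_scale W closed \<phi>W)
    qed (use * W in \<open>auto simp: inner_add_left \<phi>_coord g_def subspace_0\<close>)
    then have eq: "(1 - t) *\<^sub>R b (\<phi> x) (\<phi> x) = - t *\<^sub>R \<phi> x"
      by (simp add: add_eq_0_iff2)
    show False
    proof (cases "t = 1")
      case True
      then show False using eq \<phi>0 x by simp
    next
      case False
      then have "b (\<phi> x) (\<phi> x) = (1 / (1 - t)) *\<^sub>R ((1 - t) *\<^sub>R b (\<phi> x) (\<phi> x))"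
        by simp
      then have "b (\<phi> x) (\<phi> x) = (- t / (1 - t)) *\<^sub>R \<phi> x"
        unfolding eq by simp
      then show False using no \<phi>W \<phi>0 x by blast
    qed
  qed
  have nz_g: "\<exists>i\<le>n. g x i \<noteq> 0" if "x \<in> topspace (nsphere n)" for x
    using line [OF that, of 0] by simp
  have cmf: "continuous_map (nsphere n) (nsphere n) f"
    unfolding f_def by (rule continuous_map_nsphere_normalize [OF cont_g nz_g])
  have "homotopic_with (\<lambda>_. True) (nsphere n) (subtopology (nsphere n) UNIV)
      (\<lambda>x. nsphere_normalize n (g x)) (\<lambda>x. nsphere_normalize n (\<lambda>i. x i))"
    using line by (intro homotopic_nsphere_normalize_linear cont_g proj) auto
  then have "Brouwer_degree2 n f = Brouwer_degree2 n (nsphere_normalize n)"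
    by (simp add: f_def Brouwer_degree2_homotopic)
  also have "\<dots> = Brouwer_degree2 n id"
    using nsphere_normalize_ident [of _ n 1] by (intro Brouwer_degree2_eq) auto
  finally have deg: "Brouwer_degree2 n f = 1" by simp
  \<comment> \<open>squaring on \<open>W\<close> is null only relative to \<open>W\<close>; adding the identity of the orthogonal complement
    makes the image of the hyperplane null in the whole space\<close>
  define h where "h = (\<lambda>x. (x - p x) + b (p x) (p x))"
  have linp: "bounded_linear p"
    unfolding p_def \<phi>_def
    by (intro bounded_linear_sum bounded_linear_compose [OF bounded_linear_scaleR_left] bounded_linear_inner_left)
  have pd: "(p has_derivative p) (at x within S)" for x S
    using linp by (rule bounded_linear_imp_has_derivative)
  have "(h has_derivative (\<lambda>y. (y - p y) + (b (p x) (p y) + b (p y) (p x)))) (at x within S)" for x S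
    unfolding h_def
    by (rule has_derivative_add [OF has_derivative_diff [OF has_derivative_ident pd] b.FDERIV [OF pd pd]])
  then have "h differentiable_on {x. e n \<bullet> x = 0}"
    by (auto simp: differentiable_on_def differentiable_def)
  moreover have "negligible {x. e n \<bullet> x = 0}"
    using ee [of n n] by (intro negligible_hyperplane) auto
  ultimately have "negligible (h ` {x. e n \<bullet> x = 0})"
    by (intro negligible_differentiable_image_negligible) auto
  then have "h ` {x. e n \<bullet> x = 0} \<noteq> UNIV"
    using non_negligible_UNIV by metis
  then obtain z where z: "z \<noteq> h x" if "e n \<bullet> x = 0" for x
    by blast
  \<comment> \<open>Otherwise \<open>(z - p z) + w\<close> would be a point of the hyperplane that
    \<open>h\<close> sends to \<open>z\<close>.\<close>
  have missed: "b w w \<noteq> p z" if w: "w \<in> W" "w \<bullet> e n = 0" for w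
  proof
    assume eq: "b w w = p z"
    let ?x = "(z - p z) + w"
    have "p ?x = w"
    proof (rule W_eqI)
      fix i assume "i \<le> n"
      then show "p ?x \<bullet> e i = w \<bullet> e i"
        by (simp add: p_def \<phi>_coord inner_add_left inner_diff_left)
    qed (use w in \<open>auto simp: p_def \<phi>W\<close>)
    moreover have "e n \<bullet> ?x = 0"
      using w by (simp add: p_def \<phi>_coord inner_add_left inner_diff_left inner_commute [of "e n"])
    ultimately show False
      using z [of ?x] eq by (simp add: h_def)
  qed
  \<comment> \<open>The vector 0 lies in the hyperplane and has square 0, so the missed value
    \<open>p z\<close> is nonzero and has a direction.\<close>
  have nz_z: "\<exists>i\<le>n. z \<bullet> e i \<noteq> 0"
  proof (rule ccontr)
    assume "\<not> ?thesis"
    then have "p z = 0" by (simp add: p_def \<phi>_def)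
    then show False using missed [of 0] W by (simp add: subspace_0 b.zero_left)
  qed
  define q where "q = nsphere_normalize n (\<lambda>i. z \<bullet> e i)"
  have "continuous_map (nsphere n) (nsphere n) (\<lambda>x. q)"
    unfolding q_def using nz_z by (intro continuous_map_nsphere_normalize) auto
  then have q: "q \<in> topspace (nsphere n)"
    using in_topspace_nsphere by (auto simp: continuous_map_def)
  have "f x \<noteq> q" if x: "x \<in> topspace (nsphere n)" "x n = 0" for x
  proof
    assume "f x = q"
    then obtain c where c: "c > 0" "\<And>i. i \<le> n \<Longrightarrow> z \<bullet> e i = c * g x i"
      using nsphere_normalize_eqD [OF _ nz_g [OF x(1)] nz_z] unfolding f_def q_def by metis
    \<comment> \<open>Squaring is homogeneous of degree 2, so the factor \<open>sqrt c\<close> turns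
      an equality of directions into one of vectors.\<close>
    let ?w = "sqrt c *\<^sub>R \<phi> x"
    have "b ?w ?w = c *\<^sub>R b (\<phi> x) (\<phi> x)"
      using c(1) by (simp add: b.scaleR_left b.scaleR_right)
    also have "\<dots> = p z"
    proof (rule W_eqI)
      show "c *\<^sub>R b (\<phi> x) (\<phi> x) \<in> W" "p z \<in> W"
        by (auto simp: p_def \<phi>W intro!: subspace_scale W closed)
    qed (simp add: p_def \<phi>_coord c g_def)
    finally show False
      using missed [of ?w] x(2) by (simp add: \<phi>_coord \<phi>W W subspace_scale)
  qed
  then have "even (Brouwer_degree2 n f)"
    using cmf q by (intro even_Brouwer_degree2_even_map)
      (auto simp: f_def g_def \<phi>neg b.minus_left b.minus_right)
  then show False
    by (simp add: deg)
qed

section \<open>Nilpotency of complex linear maps\<close>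

lemma linear_iff_scalar:
  "Vector_Spaces.linear (*s) (*s) f \<longleftrightarrow> (\<forall>x y. f (x + y) = f x + f y) \<and> (\<forall>c x. f (c *s x) = c *s f x)"
  for f :: "complex^'n \<Rightarrow> complex^'m"
  unfolding Vector_Spaces.linear_def module_hom_def module_hom_axioms_def
  by (auto simp: vec.vector_space_axioms vec.module_axioms)

lemma scaleR_eq_scale: "r *\<^sub>R x = complex_of_real r *s x" for x :: "complex^'n"
  unfolding vec_eq_iff vector_scaleR_component vector_smult_component by (simp add: scaleR_conv_of_real)

lemma complex_linear_bounded_linear:
  assumes "Vector_Spaces.linear (*s) (*s) f"
  shows "bounded_linear (f :: complex^'n \<Rightarrow> complex^'m)"
  using assms by (auto simp: linear_iff_scalar scaleR_eq_scale intro!: linear_conv_bounded_linear [THEN iffD1] linearI)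

lemma linear_funpow_scalar:
  assumes "Vector_Spaces.linear (*s) (*s) f"
  shows "Vector_Spaces.linear (*s) (*s) ((f :: complex^'n \<Rightarrow> complex^'n) ^^ k)"
  using assms by (induction k) (auto simp: linear_iff_scalar)


section \<open>Polynomials in an endomorphism\<close>

definition poly_map :: "complex poly \<Rightarrow> (complex^'n \<Rightarrow> complex^'n) \<Rightarrow> complex^'n \<Rightarrow> complex^'n" where
  "poly_map p D v = (\<Sum>i\<le>degree p. coeff p i *s (D ^^ i) v)"

lemma poly_map_altdef:
  assumes "degree p \<le> n"
  shows "poly_map p D v = (\<Sum>i\<le>n. coeff p i *s (D ^^ i) v)"
  unfolding poly_map_def using assms
  by (intro sum.mono_neutral_left) (auto simp: coeff_eq_0)

text \<open>The linear factor acts on the vector first, which lets an induction on the degree pass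
  from \<open>v\<close> to \<open>D v - c *s v\<close>.\<close>

lemma poly_map_linear_factor:
  assumes D: "Vector_Spaces.linear (*s) (*s) D"
  shows "poly_map ([:- c, 1:] * q) D v = poly_map q D (D v - c *s v)"
proof -
  interpret D: Vector_Spaces.linear "(*s)" "(*s)" D by fact
  interpret Dk: Vector_Spaces.linear "(*s)" "(*s)" "D ^^ k" for k
    by (rule linear_funpow_scalar [OF D])
  let ?n = "degree q"
  have "degree ([:- c, 1:] * q) \<le> Suc ?n"
    using degree_mult_le [of "[:- c, 1:]" q] by simp
  then have "poly_map ([:- c, 1:] * q) D v = (\<Sum>i\<le>Suc ?n. coeff ([:- c, 1:] * q) i *s (D ^^ i) v)"
    by (rule poly_map_altdef)
  also have "\<dots> = (\<Sum>i\<le>Suc ?n. (case i of 0 \<Rightarrow> 0 | Suc j \<Rightarrow> coeff q j) *s (D ^^ i) v)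
      - (\<Sum>i\<le>Suc ?n. (c * coeff q i) *s (D ^^ i) v)"
    by (simp add: coeff_pCons vector_sub_rdistrib sum_subtractf)
  also have "\<dots> = (\<Sum>j\<le>?n. coeff q j *s (D ^^ j) (D v)) - (\<Sum>j\<le>?n. coeff q j *s (D ^^ j) (c *s v))"
    unfolding sum.atMost_Suc_shift [of "\<lambda>i. (case i of 0 \<Rightarrow> 0 | Suc j \<Rightarrow> coeff q j) *s (D ^^ i) v"]
    by (simp add: funpow_swap1 Dk.scale coeff_eq_0 mult.commute)
  also have "\<dots> = poly_map q D (D v - c *s v)"
    by (simp add: poly_map_def Dk.diff vec.scale_right_diff_distrib sum_subtractf)
  finally show ?thesis .
qed

lemma poly_map_annihilator:
  fixes D :: "complex^'n \<Rightarrow> complex^'n"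
  shows "\<exists>p. p \<noteq> 0 \<and> poly_map p D v = 0"
\<comment> \<open>Dependence is a property of sets: \<open>n + 1\<close> distinct iterates in
  dimension \<open>n\<close> are dependent, while a repetition among them gives the polynomial
  \<open>X^j - X^i\<close>.\<close>
proof (cases "inj_on (\<lambda>i. (D ^^ i) v) {..CARD('n)}")
  case True
  let ?f = "\<lambda>i. (D ^^ i) v"
  have "card (?f ` {..CARD('n)}) = Suc (CARD('n))"
    using True by (simp add: card_image)
  then have "vec.dependent (?f ` {..CARD('n)})"
    using vec.independent_card_le_dim [of "?f ` {..CARD('n)}" UNIV] by (auto simp: vec_dim_card card_cart_basis)
  then obtain u w where w: "w \<in> ?f ` {..CARD('n)}" "u w \<noteq> 0"
    and sum: "(\<Sum>x\<in>?f ` {..CARD('n)}. u x *s x) = 0"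
    by (auto simp: vec.dependent_finite)
  define p where "p = (\<Sum>i\<le>CARD('n). monom (u (?f i)) i)"
  have cp: "coeff p i = (if i \<le> CARD('n) then u (?f i) else 0)" for i
    by (simp add: p_def coeff_sum)
  then have "p \<noteq> 0" using w by (metis (no_types, lifting) atMost_iff coeff_0 imageE)
  moreover have "degree p \<le> CARD('n)" by (intro degree_le) (simp add: cp)
  then have "poly_map p D v = (\<Sum>i\<le>CARD('n). u (?f i) *s ?f i)"
    unfolding poly_map_altdef [OF \<open>degree p \<le> CARD('n)\<close>] by (intro sum.cong) (auto simp: cp)
  then have "poly_map p D v = 0"
    using sum by (simp add: sum.reindex [OF True])
  ultimately show ?thesis by blast
next
  case False
  then obtain i j where ij: "i < j" "(D ^^ i) v = (D ^^ j) v"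
    by (auto simp: inj_on_def) (metis linorder_neqE_nat)
  define p where "p = monom (1::complex) j - monom 1 i"
  have "coeff p j = 1" using ij(1) by (simp add: p_def)
  then have "p \<noteq> 0" by auto
  moreover have "degree p \<le> j" unfolding p_def using ij(1) by (intro degree_diff_le) (auto simp: degree_monom_eq)
  then have "poly_map p D v = (\<Sum>k\<le>j. (if k = j then 1 else 0) *s (D ^^ k) v - (if k = i then 1 else 0) *s (D ^^ k) v)"
    unfolding poly_map_altdef [OF \<open>degree p \<le> j\<close>]
    by (intro sum.cong) (auto simp: p_def vector_sub_rdistrib)
  then have "poly_map p D v = 0"
    using ij by (simp add: sum_subtractf if_distrib [of "\<lambda>c. c *s _"] cong: if_cong)
  ultimately show ?thesis by blast
qed

text \<open>Each vector is killed by a nonzero polynomial in \<open>D\<close>. Splitting off a root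
  \<open>c\<close>, induction yields \<open>k\<close> with \<open>(D ^^ k) v\<close> zero or an
  eigenvector for \<open>c\<close>; in the latter case \<open>c = 0\<close> and one more
  \<open>D\<close> kills it. The maximum over a basis makes the exponent uniform.\<close>

lemma nilpotent_if_eigenvalues_zero:
  fixes D :: "complex^'n \<Rightarrow> complex^'n"
  assumes D: "Vector_Spaces.linear (*s) (*s) D"
    and ev: "\<And>c v. v \<noteq> 0 \<Longrightarrow> D v = c *s v \<Longrightarrow> c = 0"
  obtains m where "D ^^ m = (\<lambda>v. 0)"
proof -
  interpret D: Vector_Spaces.linear "(*s)" "(*s)" D by fact
  interpret Dk: Vector_Spaces.linear "(*s)" "(*s)" "D ^^ k" for k
    by (rule linear_funpow_scalar [OF D])
  have ann: "\<exists>k. (D ^^ k) v = 0" if "p \<noteq> 0" "poly_map p D v = 0" for p v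
    using that
  proof (induction "degree p" arbitrary: p v)
    case 0
    then obtain a where "p = [:a:]" "a \<noteq> 0" by (metis degree_0_id pCons_eq_0_iff of_nat_0)
    then have "(D ^^ 0) v = 0" using 0 by (simp add: poly_map_def vec.scale_eq_0_iff)
    then show ?case by blast
  next
    case (Suc n)
    then have "\<not> constant (poly p)" by (simp add: constant_degree)
    then obtain c where "poly p c = 0" using fundamental_theorem_of_algebra by blast
    then obtain q where pq: "p = [:- c, 1:] * q" by (auto simp: poly_eq_0_iff_dvd)
    then have "q \<noteq> 0" using Suc.prems by auto
    then have "degree p = Suc (degree q)" unfolding pq by (subst degree_mult_eq) auto
    then have "n = degree q" using Suc.hyps by simp
    with Suc.hyps(1) [OF this \<open>q \<noteq> 0\<close>] Suc.prems(2) obtain k where "(D ^^ k) (D v - c *s v) = 0"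
      unfolding pq poly_map_linear_factor [OF D] by blast
    then have eig: "D ((D ^^ k) v) = c *s (D ^^ k) v"
      by (simp add: Dk.diff Dk.scale funpow_swap1)
    show ?case
    proof (cases "(D ^^ k) v = 0")
      case False
      then have "c = 0" using ev eig by blast
      then have "(D ^^ Suc k) v = 0" using eig by simp
      then show ?thesis by blast
    qed blast
  qed
  then have "\<exists>k. (D ^^ k) v = 0" for v
    using poly_map_annihilator [of D v] by blast
  then obtain k where k: "(D ^^ k v) v = 0" for v by metis
  define m where "m = Max (k ` cart_basis)"
  have up: "(D ^^ m) v = 0" if "(D ^^ k) v = 0" "k \<le> m" for k m v
    using that by (metis Dk.zero funpow_add le_Suc_ex o_apply add.commute)
  have "(D ^^ m) v = 0" if "v \<in> cart_basis" for v
    by (rule up [OF k]) (use that in \<open>simp add: m_def finite_cart_basis\<close>)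
  then have "(D ^^ m) v = 0" for v
    using Dk.eq_0_on_span [of cart_basis m v] by (auto simp: span_cart_basis)
  then show ?thesis using that by blast
qed


section \<open>Quasiderivations\<close>

lemma cbilinearD:
  assumes "cbilinear \<mu>"
  shows "\<mu> (x + y) z = \<mu> x z + \<mu> y z" "\<mu> x (y + z) = \<mu> x y + \<mu> x z"
    "\<mu> (c *s x) y = c *s \<mu> x y" "\<mu> x (c *s y) = c *s \<mu> x y"
    "\<mu> 0 y = 0" "\<mu> x 0 = 0"
    "\<mu> (x - y) z = \<mu> x z - \<mu> y z" "\<mu> x (y - z) = \<mu> x y - \<mu> x z"
proof -
  have l: "Vector_Spaces.linear (*s) (*s) (\<lambda>x. \<mu> x y)" and r: "Vector_Spaces.linear (*s) (*s) (\<mu> y)" for y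
    using assms by (auto simp: cbilinear_def)
  interpret l: Vector_Spaces.linear "(*s)" "(*s)" "\<lambda>x. \<mu> x y" for y by (rule l)
  interpret r: Vector_Spaces.linear "(*s)" "(*s)" "\<mu> x" for x by (rule r)
  show "\<mu> (x + y) z = \<mu> x z + \<mu> y z" "\<mu> x (y + z) = \<mu> x y + \<mu> x z"
    "\<mu> (c *s x) y = c *s \<mu> x y" "\<mu> x (c *s y) = c *s \<mu> x y"
    "\<mu> 0 y = 0" "\<mu> x 0 = 0"
    "\<mu> (x - y) z = \<mu> x z - \<mu> y z" "\<mu> x (y - z) = \<mu> x y - \<mu> x z"
    by (rule l.add r.add l.scale r.scale l.zero r.zero l.diff r.diff)+
qed

lemma cbilinear_bilinear: "cbilinear \<mu> \<Longrightarrow> bilinear \<mu>"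
  by (auto simp: bilinear_def scaleR_eq_scale cbilinearD intro!: linearI)

text \<open>If \<open>v\<close> were a multiple of \<open>w\<close>, multiplication by
  \<open>w\<close> would scale it by \<open>\<alpha>\<close> rather than
  \<open>\<alpha> / 2\<close>; as \<open>\<alpha>\<close> is nonzero, the two are
  independent.\<close>

lemma in_D2I:
  assumes \<mu>: "cbilinear \<mu>" and w: "w \<noteq> 0" "\<mu> w w = \<alpha> *s w" "\<alpha> \<noteq> 0"
    and v: "v \<noteq> 0" "\<mu> w v = (\<alpha> / 2) *s v"
  shows "in_D2 \<mu>"
proof -
  let ?U = "vec.span {w}"
  have "v \<noteq> c *s w" for c
  proof
    assume vw: "v = c *s w"
    then have "c *s (\<alpha> *s w) = (\<alpha> / 2) *s (c *s w)"
      using w(2) v(2) by (simp add: cbilinearD [OF \<mu>])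
    then have "(c * \<alpha> / 2) *s w = 0"
      by (simp add: vec_eq_iff)
    then show False using w v(1) vw by (simp add: vec.scale_eq_0_iff)
  qed
  then have "v \<notin> ?U" by (auto simp: vec.span_singleton)
  then have "w \<noteq> v" "vec.independent {w, v}"
    using w(1) vec.span_base [of v "{v}"] vec.independent_insert [of v "{w}"]
    by (auto simp: insert_commute vec.span_base)
  moreover have "vec.dim ?U = 1"
    using w(1) by (simp add: vec.dim_span vec.dim_eq_card_independent)
  moreover have "subalgebra \<mu> ?U"
    using vec.subspace_span [of "{w}"] w(2)
    by (auto simp: subalgebra_def vec.span_singleton cbilinearD [OF \<mu>])
  moreover have "w \<in> ?U" by (simp add: vec.span_base)
  ultimately show ?thesis
    unfolding in_D2_def singular_subalgebra_def using w(2) v(2) by blast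
qed

text \<open>The power \<open>s^k \<beta>\<close> of the Leibniz operator. For bilinear
  \<open>\<beta>\<close> it is the sum of \<open>(k choose i) \<beta>(D^i x, D^(k-i) y)\<close>; the
  recursion avoids handling that sum.\<close>

primrec leibniz_pow :: "nat \<Rightarrow> ('a \<Rightarrow> 'a) \<Rightarrow> ('a \<Rightarrow> 'a \<Rightarrow> 'b::plus) \<Rightarrow> 'a \<Rightarrow> 'a \<Rightarrow> 'b" where
  "leibniz_pow 0 D \<beta> x y = \<beta> x y"
| "leibniz_pow (Suc k) D \<beta> x y = leibniz_pow k D \<beta> (D x) y + leibniz_pow k D \<beta> x (D y)"

section \<open>Eigenvalues of a quasiderivation\<close>

context
  fixes \<mu> :: "complex^'n \<Rightarrow> complex^'n \<Rightarrow> complex^'n" and D :: "complex^'n \<Rightarrow> complex^'n"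
  assumes \<mu>: "cbilinear \<mu>" and comm: "commutative_mult \<mu>"
    and D: "Vector_Spaces.linear (*s) (*s) D" and qder: "gl_act D (gl_act D \<mu>) = (\<lambda>x y. 0)"
begin

interpretation D: Vector_Spaces.linear "(*s)" "(*s)" D by (rule D)
interpretation Dk: Vector_Spaces.linear "(*s)" "(*s)" "D ^^ k" for k
  by (rule linear_funpow_scalar [OF D])

text \<open>At \<open>(v, v)\<close> the quasiderivation identity reads
  \<open>(D - 2a)^2 w = 0\<close> for the square \<open>w\<close> of \<open>v\<close>, so
  \<open>w\<close> or \<open>(D - 2a) w\<close> is the eigenvector.\<close>

lemma qder_double_eigenvalue:
  assumes v: "v \<noteq> 0" "D v = a *s v" and D1: "\<not> in_D1 \<mu>"
  shows "\<exists>u. u \<noteq> 0 \<and> D u = (2 * a) *s u"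
proof -
  let ?w = "\<mu> v v"
  have "?w \<noteq> 0" using D1 v by (auto simp: in_D1_def)
  define u where "u = D ?w - (2 * a) *s ?w"
  have "gl_act D (gl_act D \<mu>) v v = 0" by (simp add: qder)
  then have "D u = (2 * a) *s u"
    unfolding u_def
    by (simp only: gl_act_def v cbilinearD [OF \<mu>] D.diff D.scale) (simp add: vec_eq_iff algebra_simps)
  show ?thesis
  proof (cases "u = 0")
    case True
    then have "D ?w = (2 * a) *s ?w" by (simp add: u_def)
    then show ?thesis using \<open>?w \<noteq> 0\<close> by blast
  next
    case False
    then show ?thesis using \<open>D u = (2 * a) *s u\<close> by blast
  qed
qed

lemma qder_eigenvalue_zero:
  assumes v: "v \<noteq> 0" "D v = a *s v" and D1: "\<not> in_D1 \<mu>"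
  shows "a = 0"
proof (rule ccontr)
  assume "a \<noteq> 0"
  have ex: "\<exists>u. u \<noteq> 0 \<and> D u = (2 ^ k * a) *s u" for k
  proof (induction k)
    case (Suc k)
    then obtain u where "u \<noteq> 0" "D u = (2 ^ k * a) *s u" by blast
    from qder_double_eigenvalue [OF this D1] show ?case by (simp add: mult.assoc)
  qed (use v in auto)
  obtain B where B: "norm (D x) \<le> norm x * B" for x
    using bounded_linear.bounded [OF complex_linear_bounded_linear [OF D]] by blast
  have ns: "norm (c *s u) = cmod c * norm u" for c and u :: "complex^'n"
    by (simp add: norm_vec_def norm_mult L2_set_right_distrib)
  have bound: "2 ^ k * cmod a \<le> B" for k
  proof -
    obtain u where "u \<noteq> 0" "D u = (2 ^ k * a) *s u" using ex by blast
    then show ?thesis using B [of u] by (simp add: ns norm_mult norm_power mult.commute)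
  qed
  obtain k where "B / cmod a < 2 ^ k"
    using real_arch_pow [of 2] by auto
  then show False
    using bound [of k] \<open>a \<noteq> 0\<close> by (simp add: field_simps)
qed

section \<open>Powers of \<open>D\<close> against powers of the Leibniz operator\<close>

lemma D_mult: "D (\<mu> x y) = gl_act D \<mu> x y + (\<mu> (D x) y + \<mu> x (D y))"
  by (simp add: gl_act_def)

lemma D_gl_act: "D (gl_act D \<mu> x y) = gl_act D \<mu> (D x) y + gl_act D \<mu> x (D y)"
proof -
  have "gl_act D (gl_act D \<mu>) x y = 0" by (simp add: qder)
  then show ?thesis by (subst (asm) gl_act_def) (simp add: algebra_simps)
qed

lemma funpow_gl_act: "(D ^^ k) (gl_act D \<mu> x y) = leibniz_pow k D (gl_act D \<mu>) x y"
  by (induction k arbitrary: x y) (simp_all add: funpow_Suc_right D_gl_act Dk.add del: funpow.simps(2))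

text \<open>With \<open>\<nu> = gl_act D \<mu>\<close>, \<open>D\<close> acts on values by
  \<open>\<mu> -> s \<mu> + \<nu>\<close> and \<open>\<nu> -> s \<nu>\<close>, like a Jordan block
  of size 2, whence the binomial formula with two terms. At \<open>k = 0\<close> the truncated
  \<open>k - 1\<close> carries the coefficient 0.\<close>

lemma funpow_mult:
  "(D ^^ k) (\<mu> x y) = leibniz_pow k D \<mu> x y + of_nat k *s leibniz_pow (k - 1) D (gl_act D \<mu>) x y"
proof (induction k arbitrary: x y)
  case (Suc k)
  have "of_nat k *s leibniz_pow (k - 1) D (gl_act D \<mu>) (D x) y
      + of_nat k *s leibniz_pow (k - 1) D (gl_act D \<mu>) x (D y)
      = of_nat k *s leibniz_pow k D (gl_act D \<mu>) x y"
    by (cases k) (simp_all add: vec.scale_right_distrib)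
  then show ?case
    by (simp add: funpow_Suc_right D_mult Dk.add Suc.IH funpow_gl_act algebra_simps vec.scale_left_distrib
        del: funpow.simps(2))
qed simp

text \<open>\<open>D^m = 0\<close> gives \<open>s^m \<nu> = 0\<close> and
  \<open>s^m \<mu> = - m s^(m-1) \<nu>\<close>; one more \<open>s\<close> turns the right-hand side
  into \<open>- m s^m \<nu> = 0\<close>.\<close>

lemma leibniz_pow_eq_0:
  assumes nil: "D ^^ m = (\<lambda>x. 0)" and k: "m < k"
  shows "leibniz_pow k D \<mu> x y = 0"
proof -
  obtain j where "k = Suc m + j" using k less_eqE Suc_leI by metis
  moreover have "leibniz_pow (Suc m + j) D \<mu> x y = 0"
  proof (induction j arbitrary: x y)
    case 0
    have \<nu>: "leibniz_pow m D (gl_act D \<mu>) x y = 0"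
      using funpow_gl_act [of m x y] by (simp add: nil)
    have *: "leibniz_pow m D \<mu> x y = - (of_nat m *s leibniz_pow (m - 1) D (gl_act D \<mu>) x y)" for x y
      using funpow_mult [of m x y] by (simp add: nil eq_neg_iff_add_eq_0)
    \<comment> \<open>For \<open>m = 0\<close> the hypothesis makes every vector zero, which covers
      the truncated \<open>m - 1\<close>.\<close>
    have "m \<noteq> 0 \<or> (\<forall>z. z = (0::complex^'n))" using nil by (metis funpow_0)
    then have "leibniz_pow m D (gl_act D \<mu>) x y =
        leibniz_pow (m - 1) D (gl_act D \<mu>) (D x) y + leibniz_pow (m - 1) D (gl_act D \<mu>) x (D y)"
      by (cases m) auto
    moreover have "leibniz_pow (Suc m) D \<mu> x y = - (of_nat m *s (leibniz_pow (m - 1) D (gl_act D \<mu>) (D x) y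
        + leibniz_pow (m - 1) D (gl_act D \<mu>) x (D y)))"
      by (simp add: * vec.scale_right_distrib)
    ultimately show ?case by (simp add: \<nu>)
  qed simp
  ultimately show ?thesis by simp
qed

lemma leibniz_pow_zero: "leibniz_pow k D \<mu> 0 y = 0" "leibniz_pow k D \<mu> x 0 = 0"
  by (induction k arbitrary: x y) (simp_all add: cbilinearD [OF \<mu>] D.zero)

text \<open>Every other term of the binomial expansion has more than \<open>a\<close> factors
  \<open>D\<close> on \<open>x\<close> or more than \<open>b\<close> on \<open>y\<close>. The
  induction is Pascal's rule.\<close>

lemma leibniz_pow_extremal:
  assumes "(D ^^ Suc a) x = 0" "(D ^^ Suc b) y = 0"
  shows "leibniz_pow (a + b) D \<mu> x y = of_nat ((a + b) choose a) *s \<mu> ((D ^^ a) x) ((D ^^ b) y)"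
  using assms
proof (induction "a + b" arbitrary: a b x y)
  case (Suc k)
  have 1: "leibniz_pow k D \<mu> (D x) y = of_nat (if a = 0 then 0 else k choose (a - 1)) *s \<mu> ((D ^^ a) x) ((D ^^ b) y)"
  proof (cases a)
    case 0
    then show ?thesis using Suc.prems by (simp add: leibniz_pow_zero)
  next
    case (Suc i)
    then show ?thesis using Suc.hyps(1) [of i b "D x" y] Suc.hyps(2) Suc.prems
      by (simp add: funpow_swap1)
  qed
  have 2: "leibniz_pow k D \<mu> x (D y) = of_nat (if b = 0 then 0 else k choose a) *s \<mu> ((D ^^ a) x) ((D ^^ b) y)"
  proof (cases b)
    case 0
    then show ?thesis using Suc.prems by (simp add: leibniz_pow_zero)
  next
    case (Suc i)
    then show ?thesis using Suc.hyps(1) [of a i x "D y"] Suc.hyps(2) Suc.prems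
      by (simp add: funpow_swap1)
  qed
  have "(Suc k choose a) = (if a = 0 then 0 else k choose (a - 1)) + (if b = 0 then 0 else k choose a)"
    using Suc.hyps(2) by (cases a; cases b) auto
  then show ?case
    by (simp add: 1 2 vec.scale_left_distrib flip: Suc.hyps(2))
qed simp

lemma qder_nilpotent_square_zero:
  assumes D1: "\<not> in_D1 \<mu>" and nil: "D ^^ m = (\<lambda>x. 0)"
  shows "D (D x) = 0"
proof (rule ccontr)
  assume x: "D (D x) \<noteq> 0"
  define p where "p = (LEAST k. D ^^ Suc k = (\<lambda>x. 0))"
  have "m \<noteq> 0" using nil x by (metis funpow_0)
  then have "\<exists>k. D ^^ Suc k = (\<lambda>x. 0)" using nil by (metis not0_implies_Suc)
  then have p: "D ^^ Suc p = (\<lambda>x. 0)" unfolding p_def by (rule LeastI_ex)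
  have "p \<noteq> 0" using x p by (cases "p = 0") (simp_all add: fun_eq_iff)
  have "p \<noteq> 1" using x p by (cases "p = 1") (simp_all add: fun_eq_iff)
  have "D ^^ Suc (p - 1) \<noteq> (\<lambda>x. 0)"
    using \<open>p \<noteq> 0\<close> not_less_Least [of "p - 1" "\<lambda>k. D ^^ Suc k = (\<lambda>x. 0)"] by (fold p_def) auto
  then have "D ^^ p \<noteq> (\<lambda>x. 0)" using \<open>p \<noteq> 0\<close> by (metis Suc_pred' bot_nat_0.not_eq_extremum)
  then obtain z where z: "(D ^^ p) z \<noteq> 0" by auto
  \<comment> \<open>Vanishing starts above \<open>p + 1\<close>, and \<open>p + 1 < 2p\<close> is
    where \<open>p \<ge> 2\<close> enters.\<close>
  have "leibniz_pow (p + p) D \<mu> z z = 0"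
    by (rule leibniz_pow_eq_0 [OF p]) (use \<open>p \<noteq> 0\<close> \<open>p \<noteq> 1\<close> in linarith)
  moreover have "leibniz_pow (p + p) D \<mu> z z = of_nat ((p + p) choose p) *s \<mu> ((D ^^ p) z) ((D ^^ p) z)"
    using p by (intro leibniz_pow_extremal) auto
  ultimately have "\<mu> ((D ^^ p) z) ((D ^^ p) z) = 0"
    by (simp add: vec.scale_eq_0_iff)
  then show False using D1 z by (auto simp: in_D1_def)
qed

text \<open>An idempotent line spanned by \<open>w = D x\<close> yields an operator
  \<open>L\<close>, multiplication by \<open>w\<close> minus \<open>\<alpha> / 2\<close>, that
  preserves \<open>ker D\<close> and sends \<open>x\<close>, which is outside \<open>ker D\<close>,
  into it. So \<open>L\<close> cannot be injective, and a kernel vector makes the line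
  singular.\<close>

lemma qder_square_zero:
  assumes D1: "\<not> in_D1 \<mu>" and D2: "\<not> in_D2 \<mu>" and sq: "\<And>x. D (D x) = 0"
  shows "D x = 0"
proof (rule ccontr)
  assume "D x \<noteq> 0"
  have id: "\<mu> (D x) (D y) = D (\<mu> (D x) y + \<mu> x (D y))" for x y
  proof -
    have "gl_act D (gl_act D \<mu>) x y = 0" by (simp add: qder)
    then have "2 *s \<mu> (D x) (D y) = 2 *s D (\<mu> (D x) y + \<mu> x (D y))"
      by (simp add: gl_act_def sq D.add D.diff cbilinearD [OF \<mu>]) (simp add: vec_eq_iff algebra_simps)
    then show ?thesis by (simp add: vec.scale_left_imp_eq)
  qed
  \<comment> \<open>The complex range is taken as a real subspace; the real multiplier found there
    becomes the complex \<open>\<alpha>\<close>.\<close>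
  have "subspace (range D)"
    using bounded_linear.linear [OF complex_linear_bounded_linear [OF D]] by (rule linear_subspace_image) simp
  moreover have "range D \<noteq> {0}" using \<open>D x \<noteq> 0\<close> by blast
  moreover have "\<mu> w w \<in> range D" if "w \<in> range D" for w
    using that id by force
  ultimately obtain w r where w: "w \<in> range D" "w \<noteq> 0" and "\<mu> w w = r *\<^sub>R w"
    using bilinear_idempotent_line [OF cbilinear_bilinear [OF \<mu>]] by metis
  then obtain \<alpha> where ww: "\<mu> w w = \<alpha> *s w" by (auto simp: scaleR_eq_scale)
  obtain x where x: "w = D x" using w by blast
  have "\<alpha> \<noteq> 0"
  proof
    assume "\<alpha> = 0"
    then have "\<mu> w w = 0" by (simp add: ww)
    then show False using D1 w(2) unfolding in_D1_def by blast
  qed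
  define L where "L = (\<lambda>y. \<mu> w y - (\<alpha> / 2) *s y)"
  define K where "K = {y. D y = 0}"
  have linL: "Vector_Spaces.linear (*s) (*s) L"
    by (simp add: linear_iff_scalar L_def cbilinearD [OF \<mu>] vec_eq_iff algebra_simps)
  interpret L: Vector_Spaces.linear "(*s)" "(*s)" L by (rule linL)
  have K: "vec.subspace K"
    by (auto simp: K_def vec.subspace_def D.add D.scale D.zero)
  have LK: "L ` K \<subseteq> K"
  proof -
    have "D (\<mu> w y) = 0" if "D y = 0" for y
      using id [of x y] that x by (simp add: cbilinearD [OF \<mu>])
    then show ?thesis by (auto simp: K_def L_def D.diff D.scale)
  qed
  have Lx: "L x \<in> K"
  proof -
    \<comment> \<open>By commutativity the identity at \<open>(x, x)\<close> gives
      \<open>\<alpha> w = 2 D(w x)\<close>, that is \<open>D (L x) = 0\<close>.\<close>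
    have "\<mu> x w = \<mu> w x" using comm by (simp add: commutative_mult_def)
    then have "\<alpha> *s w = D (\<mu> w x) + D (\<mu> w x)"
      using id [of x x] by (simp only: D.add ww flip: x)
    then show ?thesis
      by (simp add: K_def L_def D.diff D.scale flip: x) (simp add: vec_eq_iff field_simps)
  qed
  have inj: "inj L"
  proof (rule L.inj_iff_eq_0 [THEN iffD2], intro allI impI)
    fix v assume "L v = 0"
    then show "v = 0"
      using in_D2I [OF \<mu> w(2) ww \<open>\<alpha> \<noteq> 0\<close>] D2 by (auto simp: L_def)
  qed
  \<comment> \<open>An injective \<open>L\<close> maps the finite-dimensional \<open>K\<close> onto
    itself, so \<open>L x\<close> already has a preimage in \<open>K\<close>, which must be
    \<open>x\<close>.\<close>
  have "vec.dim (L ` K) = vec.dim K"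
    using inj by (intro vec.dim_image_eq linL) (auto intro: inj_on_subset)
  then have "L ` K = K"
    using LK K by (intro vec.subspace_dim_equal L.subspace_image) auto
  then obtain k where "k \<in> K" "L x = L k" using Lx by auto
  then have "x \<in> K" using inj by (auto dest: injD)
  then show False using w x by (simp add: K_def)
qed

end

theorem theorem10p8:
  fixes \<mu> :: "complex^('n::finite) \<Rightarrow> complex^('n::finite) \<Rightarrow> complex^('n::finite)"
  assumes "cbilinear \<mu>" and "commutative_mult \<mu>"
    and "\<not> in_D1 \<mu>" and "\<not> in_D2 \<mu>"
  shows "QDer \<mu> = {\<lambda>x. 0}"
proof
  show "QDer \<mu> \<subseteq> {\<lambda>x. 0}"
  proof
    fix D assume "D \<in> QDer \<mu>"
    then have D: "Vector_Spaces.linear (*s) (*s) D" "gl_act D (gl_act D \<mu>) = (\<lambda>x y. 0)"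
      by (auto simp: QDer_def)
    note qd = assms(1,2) D
    obtain m where "D ^^ m = (\<lambda>v. 0)"
      using nilpotent_if_eigenvalues_zero [OF D(1)] qder_eigenvalue_zero [OF qd _ _ assms(3)] by blast
    then have "D (D x) = 0" for x
      by (rule qder_nilpotent_square_zero [OF qd assms(3)])
    then have "D x = 0" for x
      by (rule qder_square_zero [OF qd assms(3,4)])
    then show "D \<in> {\<lambda>x. 0}" by auto
  qed
  show "{\<lambda>x. 0} \<subseteq> QDer \<mu>"
    by (auto simp: QDer_def gl_act_def linear_iff_scalar cbilinearD [OF assms(1)])
qed

end
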